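(* Let $G$ be a finite group with identity element $e$, and let $R=\bigoplus_{g\in G}R_g$ be a $G$-graded PI ring which is graded local, that is, $R$ has a unique maximal homogeneous right ideal. Assume that the order of $G$ is a unit in $R$ and that $R_gR_{g^{-1}}=0$ for every $g\in G\setminus\{e\}$. If $R_e$ is nil clean, then $R$ is graded nil clean.
   Context: All rings are associative with identity. A ring $R$ is $G$-graded if $R=\bigoplus_{g\in G}R_g$ with additive subgroups $R_g$ satisfying $R_gR_h\subseteq R_{gh}$ for all $g,h\in G$; elements of $\bigcup_{g\in G}R_g$ are called homogeneous. A right ideal $I$ is homogeneous if $I=\bigoplus_{g\in G}I\cap R_g$; a maximal homogeneous right ideal is one maximal among proper homogeneous right ideals. A PI ring is a ring satisfying a polynomial identity. A ring is nil clean if each of its elements is the sum of an idempotent and a nilpotent element. A $G$-graded ring is graded nil clean if each of its homogeneous elements is the sum of a homogeneous idempotent and a homogeneous nilpotent element. *)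

theory Defs
  imports "HOL-Algebra.Algebra" "HOL-Library.Poly_Mapping"
begin

subsection \<open>Graded rings\<close>

text \<open>\<open>S\<close> is the internal direct sum of the family \<open>B j\<close>, \<open>j \<in> J\<close>: the summation map from the
  external direct sum (finitely supported families) to \<open>S\<close> is an isomorphism of additive groups.
  The sum runs over the support because \<^const>\<open>finsum\<close> over an infinite set is zero by convention.\<close>

definition internal_direct_sum ::
    "('a, 'm) ring_scheme \<Rightarrow> 'i set \<Rightarrow> ('i \<Rightarrow> 'a set) \<Rightarrow> 'a set \<Rightarrow> bool" where
  "internal_direct_sum R J B S \<longleftrightarrow>
     (\<lambda>f. \<Oplus>\<^bsub>R\<^esub>j\<in>{j \<in> J. f j \<noteq> \<zero>\<^bsub>R\<^esub>}. f j)
       \<in> iso (sum_group J (\<lambda>j. add_monoid (R\<lparr>carrier := B j\<rparr>))) (add_monoid (R\<lparr>carrier := S\<rparr>))"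

text \<open>A \<open>G\<close>-graded unital ring with components \<open>A g\<close>. As \<open>A (g \<otimes> h)\<close> is an additive subgroup, the
  inclusion for the setwise product \<open><#>\<close> is the same as for the additive group it spans.\<close>

locale graded_ring = G: group G + R: ring R
  for G :: "('g, 'm) monoid_scheme" and R :: "('a, 'n) ring_scheme" +
  fixes A :: "'g \<Rightarrow> 'a set"
  assumes component_subgroup: "g \<in> carrier G \<Longrightarrow> additive_subgroup (A g) R"
    and direct_sum: "internal_direct_sum R (carrier G) A (carrier R)"
    and component_mult:
      "g \<in> carrier G \<Longrightarrow> h \<in> carrier G \<Longrightarrow> A g <#>\<^bsub>R\<^esub> A h \<subseteq> A (g \<otimes>\<^bsub>G\<^esub> h)"

definition homogeneous :: "('g, 'm) monoid_scheme \<Rightarrow> ('g \<Rightarrow> 'a set) \<Rightarrow> 'a set" where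
  "homogeneous G A = (\<Union>g\<in>carrier G. A g)"

definition right_ideal :: "'a set \<Rightarrow> ('a, 'n) ring_scheme \<Rightarrow> bool" where
  "right_ideal I R \<longleftrightarrow>
     additive_subgroup I R \<and> (\<forall>a\<in>I. \<forall>r\<in>carrier R. a \<otimes>\<^bsub>R\<^esub> r \<in> I)"

definition homogeneous_right_ideal ::
    "('g, 'm) monoid_scheme \<Rightarrow> ('a, 'n) ring_scheme \<Rightarrow> ('g \<Rightarrow> 'a set) \<Rightarrow> 'a set \<Rightarrow> bool" where
  "homogeneous_right_ideal G R A I \<longleftrightarrow>
     right_ideal I R \<and> internal_direct_sum R (carrier G) (\<lambda>g. I \<inter> A g) I"

definition maximal_homogeneous_right_ideal ::
    "('g, 'm) monoid_scheme \<Rightarrow> ('a, 'n) ring_scheme \<Rightarrow> ('g \<Rightarrow> 'a set) \<Rightarrow> 'a set \<Rightarrow> bool" where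
  "maximal_homogeneous_right_ideal G R A M \<longleftrightarrow>
     homogeneous_right_ideal G R A M \<and> M \<noteq> carrier R \<and>
     (\<forall>J. homogeneous_right_ideal G R A J \<and> J \<noteq> carrier R \<and> M \<subseteq> J \<longrightarrow> J = M)"

definition graded_local ::
    "('g, 'm) monoid_scheme \<Rightarrow> ('a, 'n) ring_scheme \<Rightarrow> ('g \<Rightarrow> 'a set) \<Rightarrow> bool" where
  "graded_local G R A \<longleftrightarrow> (\<exists>!M. maximal_homogeneous_right_ideal G R A M)"

subsection \<open>Polynomial identities\<close>

text \<open>Elements of the free algebra over the integers in the noncommuting variables \<open>X\<^sub>0, X\<^sub>1, \<dots>\<close>
  are finitely supported integer-valued functions on words: the word \<open>[i, j, \<dots>]\<close> is the monomial
  \<open>X\<^sub>i X\<^sub>j \<dots>\<close>.\<close>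

type_synonym nc_poly = "nat list \<Rightarrow>\<^sub>0 int"

definition eval_word :: "('a, 'n) ring_scheme \<Rightarrow> (nat \<Rightarrow> 'a) \<Rightarrow> nat list \<Rightarrow> 'a" where
  "eval_word R x w = foldr (\<lambda>i y. x i \<otimes>\<^bsub>R\<^esub> y) w \<one>\<^bsub>R\<^esub>"

definition eval_nc_poly :: "('a, 'n) ring_scheme \<Rightarrow> (nat \<Rightarrow> 'a) \<Rightarrow> nc_poly \<Rightarrow> 'a" where
  "eval_nc_poly R x p =
     (\<Oplus>\<^bsub>R\<^esub>w\<in>Poly_Mapping.keys p. [Poly_Mapping.lookup p w] \<cdot>\<^bsub>R\<^esub> eval_word R x w)"

text \<open>Some monomial of highest degree has coefficient 1. This is the usual nondegeneracy
  requirement on a polynomial identity with integer coefficients; with merely nonzero polynomials,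
  every ring of positive characteristic would be PI.\<close>

definition monic_nc_poly :: "nc_poly \<Rightarrow> bool" where
  "monic_nc_poly p \<longleftrightarrow>
     (\<exists>w\<in>Poly_Mapping.keys p. Poly_Mapping.lookup p w = 1 \<and>
        (\<forall>v\<in>Poly_Mapping.keys p. length v \<le> length w))"

definition PI_ring :: "('a, 'n) ring_scheme \<Rightarrow> bool" where
  "PI_ring R \<longleftrightarrow>
     ring R \<and> (\<exists>p. monic_nc_poly p \<and> (\<forall>x \<in> UNIV \<rightarrow> carrier R. eval_nc_poly R x p = \<zero>\<^bsub>R\<^esub>))"

subsection \<open>Nil clean rings\<close>

definition idempotent_elem :: "('a, 'n) ring_scheme \<Rightarrow> 'a \<Rightarrow> bool" where
  "idempotent_elem R x \<longleftrightarrow> x \<in> carrier R \<and> x \<otimes>\<^bsub>R\<^esub> x = x"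

definition nilpotent_elem :: "('a, 'n) ring_scheme \<Rightarrow> 'a \<Rightarrow> bool" where
  "nilpotent_elem R x \<longleftrightarrow> x \<in> carrier R \<and> (\<exists>n::nat. x [^]\<^bsub>R\<^esub> n = \<zero>\<^bsub>R\<^esub>)"

definition nil_clean :: "('a, 'n) ring_scheme \<Rightarrow> bool" where
  "nil_clean R \<longleftrightarrow>
     (\<forall>x\<in>carrier R. \<exists>f n. idempotent_elem R f \<and> nilpotent_elem R n \<and> x = f \<oplus>\<^bsub>R\<^esub> n)"

definition graded_nil_clean ::
    "('g, 'm) monoid_scheme \<Rightarrow> ('a, 'n) ring_scheme \<Rightarrow> ('g \<Rightarrow> 'a set) \<Rightarrow> bool" where
  "graded_nil_clean G R A \<longleftrightarrow>
     (\<forall>x\<in>homogeneous G A. \<exists>f\<in>homogeneous G A. \<exists>n\<in>homogeneous G A.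
        idempotent_elem R f \<and> nilpotent_elem R n \<and> x = f \<oplus>\<^bsub>R\<^esub> n)"

end

theory Submission
  imports Defs
begin

text \<open>A power \<open>x ^ k\<close> of an element of degree \<open>g\<close> has degree \<open>g ^ k\<close>.  As \<open>G\<close> is finite, some power of \<open>x\<close> with
  positive exponent has degree \<open>g\<^sup>-\<^sup>1\<close>, so if \<open>g\<close> is not the identity, the next power lies in
  \<open>R\<^sub>g R\<^bsub>g\<^sup>-\<^sup>1\<^esub> = 0\<close>.  Hence every homogeneous element outside \<open>R\<^sub>e\<close> is nilpotent, and \<open>x = 0 + x\<close> is a
  decomposition of the required form (\<open>nilpotent_of_finite_order_degree\<close>).  An element of \<open>R\<^sub>e\<close> is
  decomposed inside \<open>R\<^sub>e\<close>, where all elements are homogeneous of degree \<open>e\<close>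
  (\<open>identity_component_decomposition\<close>).\<close>

context graded_ring
begin

lemma component_subset: "g \<in> carrier G \<Longrightarrow> A g \<subseteq> carrier R"
  using additive_subgroup.a_subset[OF component_subgroup] by blast

lemma zero_in_component: "g \<in> carrier G \<Longrightarrow> \<zero>\<^bsub>R\<^esub> \<in> A g"
  using additive_subgroup.zero_closed[OF component_subgroup] by blast

lemma mult_in_component:
  assumes "g \<in> carrier G" "h \<in> carrier G" "x \<in> A g" "y \<in> A h"
  shows "x \<otimes>\<^bsub>R\<^esub> y \<in> A (g \<otimes>\<^bsub>G\<^esub> h)"
  using component_mult[OF assms(1,2)] assms(3,4) by (auto simp: set_mult_def)

text \<open>The exponent is positive: at zero the claim would be that the unit of the ring has degree \<open>e\<close>.\<close>

lemma power_in_component: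
  assumes "g \<in> carrier G" "x \<in> A g"
  shows "x [^]\<^bsub>R\<^esub> Suc k \<in> A (g [^]\<^bsub>G\<^esub> Suc k)"
proof (induction k)
  case 0
  then show ?case
    using assms subsetD[OF component_subset[OF assms(1)] assms(2)] by simp
next
  case (Suc k)
  have "x [^]\<^bsub>R\<^esub> Suc k \<otimes>\<^bsub>R\<^esub> x \<in> A (g [^]\<^bsub>G\<^esub> Suc k \<otimes>\<^bsub>G\<^esub> g)"
    by (rule mult_in_component[OF _ assms(1) Suc.IH assms(2)]) (use assms in blast)
  then show ?case
    by simp
qed

text \<open>If \<open>g ^ n = e\<close>, then \<open>x ^ (n - 1)\<close> has degree \<open>g\<^sup>-\<^sup>1\<close>, so \<open>x ^ n\<close> lies in a product of opposite
  components, which vanishes.\<close>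

lemma nilpotent_of_finite_order_degree:
  fixes n :: nat
  assumes g: "g \<in> carrier G" "g \<noteq> \<one>\<^bsub>G\<^esub>"
    and n: "g [^]\<^bsub>G\<^esub> n = \<one>\<^bsub>G\<^esub>" "n > 0"
    and zero: "A g <#>\<^bsub>R\<^esub> A (inv\<^bsub>G\<^esub> g) = {\<zero>\<^bsub>R\<^esub>}"
    and x: "x \<in> A g"
  shows "nilpotent_elem R x"
proof -
  have xR: "x \<in> carrier R"
    using component_subset g x by blast
  \<comment> \<open>The exponent \<open>n - 1\<close> must be positive for the degree of the power to be known.\<close>
  have "n \<noteq> 1"
    using n(1) g G.nat_pow_eone[OF g(1)] by metis
  then obtain k where k: "n = Suc (Suc k)"
    using n(2) by (cases n rule: nat.exhaust; cases "n - 1") auto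
  have "g [^]\<^bsub>G\<^esub> Suc k \<otimes>\<^bsub>G\<^esub> g = \<one>\<^bsub>G\<^esub>"
    using n(1) k by simp
  then have "inv\<^bsub>G\<^esub> g = g [^]\<^bsub>G\<^esub> Suc k"
    using g by (intro G.inv_equality) auto
  then have "x [^]\<^bsub>R\<^esub> Suc k \<in> A (inv\<^bsub>G\<^esub> g)"
    using power_in_component[OF g(1) x] by simp
  then have "x \<otimes>\<^bsub>R\<^esub> x [^]\<^bsub>R\<^esub> Suc k \<in> A g <#>\<^bsub>R\<^esub> A (inv\<^bsub>G\<^esub> g)"
    using x unfolding set_mult_def by blast
  then have "x [^]\<^bsub>R\<^esub> Suc (Suc k) = \<zero>\<^bsub>R\<^esub>"
    using zero R.nat_pow_Suc2[OF xR, of "Suc k"] by (metis singletonD)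
  then show ?thesis
    using xR unfolding nilpotent_elem_def by blast
qed

text \<open>Restricting the carrier changes neither the unit nor the operations, so powers, idempotents and
  nilpotents of \<open>R\<^sub>e\<close> are those of the whole ring.\<close>

lemma identity_component_decomposition:
  assumes "nil_clean (R\<lparr>carrier := A \<one>\<^bsub>G\<^esub>\<rparr>)" "x \<in> A \<one>\<^bsub>G\<^esub>"
  shows "\<exists>f\<in>A \<one>\<^bsub>G\<^esub>. \<exists>n\<in>A \<one>\<^bsub>G\<^esub>. idempotent_elem R f \<and> nilpotent_elem R n \<and> x = f \<oplus>\<^bsub>R\<^esub> n"
proof -
  obtain f n where fn: "idempotent_elem (R\<lparr>carrier := A \<one>\<^bsub>G\<^esub>\<rparr>) f"
      "nilpotent_elem (R\<lparr>carrier := A \<one>\<^bsub>G\<^esub>\<rparr>) n" "x = f \<oplus>\<^bsub>R\<^esub> n"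
    using assms unfolding nil_clean_def by auto
  have "f \<in> A \<one>\<^bsub>G\<^esub>" "n \<in> A \<one>\<^bsub>G\<^esub>"
    using fn by (simp_all add: idempotent_elem_def nilpotent_elem_def)
  moreover have "idempotent_elem R f" "nilpotent_elem R n"
    using fn component_subset[OF G.one_closed]
    by (auto simp: idempotent_elem_def nilpotent_elem_def nat_pow_def)
  ultimately show ?thesis
    using fn(3) by blast
qed

end

theorem theorem3p27:
  fixes G :: "('g, 'm) monoid_scheme"
    and R :: "('a, 'n) ring_scheme"
    and A :: "'g \<Rightarrow> 'a set"
  assumes graded: "graded_ring G R A"
    and fin: "finite (carrier G)"
    and PI: "PI_ring R"
    and local: "graded_local G R A"
    and unit: "[order G] \<cdot>\<^bsub>R\<^esub> \<one>\<^bsub>R\<^esub> \<in> Units R"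
    and zero: "\<And>g. g \<in> carrier G - {\<one>\<^bsub>G\<^esub>} \<Longrightarrow> A g <#>\<^bsub>R\<^esub> A (inv\<^bsub>G\<^esub> g) = {\<zero>\<^bsub>R\<^esub>}"
    and nil_clean: "nil_clean (R\<lparr>carrier := A \<one>\<^bsub>G\<^esub>\<rparr>)"
  shows "graded_nil_clean G R A"
proof -
  interpret graded_ring G R A
    by (rule graded)
  show ?thesis
    unfolding graded_nil_clean_def
  proof
    fix x
    assume "x \<in> homogeneous G A"
    then obtain g where g: "g \<in> carrier G" and x: "x \<in> A g"
      unfolding homogeneous_def by blast
    have component_homogeneous: "A h \<subseteq> homogeneous G A" if "h \<in> carrier G" for h
      using that unfolding homogeneous_def by blast
    show "\<exists>f\<in>homogeneous G A. \<exists>n\<in>homogeneous G A.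
        idempotent_elem R f \<and> nilpotent_elem R n \<and> x = f \<oplus>\<^bsub>R\<^esub> n"
    proof (cases "g = \<one>\<^bsub>G\<^esub>")
      case True
      then show ?thesis
        using identity_component_decomposition[OF nil_clean] x
          component_homogeneous[OF G.one_closed] by blast
    next
      case False
      have "order G > 0"
        using fin G.order_gt_0_iff_finite by blast
      then have "nilpotent_elem R x"
        using nilpotent_of_finite_order_degree[OF g False G.pow_order_eq_1[OF g] _ _ x]
          zero g False by blast
      moreover have "idempotent_elem R \<zero>\<^bsub>R\<^esub>"
        by (simp add: idempotent_elem_def)
      moreover have "x = \<zero>\<^bsub>R\<^esub> \<oplus>\<^bsub>R\<^esub> x"
        using subsetD[OF component_subset[OF g] x] by simp
      ultimately show ?thesis
        using component_homogeneous[OF g] zero_in_component[OF g] x by blast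
    qed
  qed
qed

end
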